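(* Up to isomorphism, $\mathbf{Forb}_{\mathrm{mz}\leq 3}$ consists exactly of the $25$ graphs $P_5, G_2, G_3,\dots,G_{25}$ listed in the context.
   Context: All graphs are finite and simple. Zero forcing: each vertex of a graph $G$ is blue or white. Color change rule: if $x$ is a blue vertex and $y$ is the only white neighbor of $x$, then $y$ turns blue. A set $B\subseteq V(G)$ is a zero forcing set if, starting with exactly the vertices of $B$ blue, all vertices of $G$ can be made blue by repeated applications of the rule. The zero forcing number $Z(G)$ is the minimum cardinality of a zero forcing set of $G$, and $\mathrm{mz}(G)=|V(G)|-Z(G)$. $\mathbf{Forb}_{\mathrm{mz}\leq 3}$ denotes the set of graphs $H$ (up to isomorphism) that are minimal forbidden for graphs with $\mathrm{mz}\leq 3$, i.e. $\mathrm{mz}(H)\geq 4$ and $\mathrm{mz}(H')\leq 3$ for every proper induced subgraph $H'$ of $H$. The $25$ graphs are as follows, where $ij$ denotes the edge $\{i,j\}$. $P_5$ on vertices $0,\dots,4$: $02,04,13,14$. On vertices $0,\dots,5$: $G_2$: $04,14,25,35,45$. $G_3$: $04,05,14,15,25,35$. $G_4$: $04,05,14,25,35,45$. $G_5$: $04,05,14,15,25,35,45$. $G_6$: $04,05,14,15,24,35,45$. $G_7$: $03,05,14,15,25,35$. $G_8$: $03,04,05,14,15,25$. $G_9$: $03,04,05,14,25,45$. $G_{10}$: $03,04,05,14,15,25,35$. $G_{11}$: $03,04,05,14,15,25,45$. $G_{12}$: $03,04,05,14,15,25,35,45$. $G_{13}$: $03,05,14,15,24,25,45$. $G_{14}$: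 $03,04,05,14,15,24,35,45$. $G_{15}$: $02,04,05,13,14,15,24,35$. $G_{16}$: $02,04,05,13,14,15,24,35,45$. On vertices $0,\dots,6$: $G_{17}$: $04,06,15,16,26,36,46,56$. $G_{18}$: $04,05,06,15,16,25,26,36,45,46$. $G_{19}$: $04,05,06,15,16,25,26,36,45,46,56$. On vertices $0,\dots,5$: $G_{20}$: $04,14,25,35$. $G_{21}$: $03,05,14,25$. On vertices $0,\dots,6$: $G_{22}$: $04,15,26,36$. $G_{23}$: $04,06,15,26,36,46$. $G_{24}$: $04,15,16,25,26,36,56$. On vertices $0,\dots,7$: $G_{25}$: $04,15,26,37$. *)

theory Defs
  imports Main
begin

type_synonym 'a graph = "'a set \<times> 'a set set"

abbreviation verts :: "'a graph \<Rightarrow> 'a set" where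
  "verts G \<equiv> fst G"

abbreviation edges :: "'a graph \<Rightarrow> 'a set set" where
  "edges G \<equiv> snd G"

definition simple_graph :: "'a graph \<Rightarrow> bool" where
  "simple_graph G \<longleftrightarrow> finite (verts G) \<and> (\<forall>e\<in>edges G. e \<subseteq> verts G \<and> card e = 2)"

definition neighbors :: "'a graph \<Rightarrow> 'a \<Rightarrow> 'a set" where
  "neighbors G x = {y. {x, y} \<in> edges G}"

definition induced :: "'a graph \<Rightarrow> 'a set \<Rightarrow> 'a graph" where
  "induced G W = (W, {e \<in> edges G. e \<subseteq> W})"

definition graph_iso :: "'a graph \<Rightarrow> 'b graph \<Rightarrow> bool" where
  "graph_iso G H \<longleftrightarrow> (\<exists>f. bij_betw f (verts G) (verts H) \<and>
     (\<forall>x\<in>verts G. \<forall>y\<in>verts G. {x, y} \<in> edges G \<longleftrightarrow> {f x, f y} \<in> edges H))"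

(* One application of the color change rule; B and B' are the sets of blue vertices
   before and after it. *)
definition force_step :: "'a graph \<Rightarrow> 'a set \<Rightarrow> 'a set \<Rightarrow> bool" where
  "force_step G B B' \<longleftrightarrow> (\<exists>x\<in>B. \<exists>y. neighbors G x - B = {y} \<and> B' = insert y B)"

definition zero_forcing_set :: "'a graph \<Rightarrow> 'a set \<Rightarrow> bool" where
  "zero_forcing_set G B \<longleftrightarrow> B \<subseteq> verts G \<and> (force_step G)\<^sup>*\<^sup>* B (verts G)"

definition zero_forcing_number :: "'a graph \<Rightarrow> nat" where
  "zero_forcing_number G = (LEAST k. \<exists>B. zero_forcing_set G B \<and> card B = k)"

(* Never truncated for a finite graph: the whole vertex set is a zero forcing set. *)
definition mz :: "'a graph \<Rightarrow> nat" where
  "mz G = card (verts G) - zero_forcing_number G"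

definition Forb_mz_le :: "nat \<Rightarrow> 'a graph set" where
  "Forb_mz_le k = {H. simple_graph H \<and> mz H > k \<and> (\<forall>W. W \<subset> verts H \<longrightarrow> mz (induced H W) \<le> k)}"

definition graph_of :: "nat \<Rightarrow> (nat \<times> nat) list \<Rightarrow> nat graph" where
  "graph_of n ps = ({..<n}, (\<lambda>(i, j). {i, j}) ` set ps)"

(* P5, G2, G3, ..., G25, in this order. *)
definition listed_graphs :: "nat graph list" where
  "listed_graphs =
    [
     graph_of 5 [(0,2), (0,4), (1,3), (1,4)],
     graph_of 6 [(0,4), (1,4), (2,5), (3,5), (4,5)],
     graph_of 6 [(0,4), (0,5), (1,4), (1,5), (2,5), (3,5)],
     graph_of 6 [(0,4), (0,5), (1,4), (2,5), (3,5), (4,5)],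
     graph_of 6 [(0,4), (0,5), (1,4), (1,5), (2,5), (3,5), (4,5)],
     graph_of 6 [(0,4), (0,5), (1,4), (1,5), (2,4), (3,5), (4,5)],
     graph_of 6 [(0,3), (0,5), (1,4), (1,5), (2,5), (3,5)],
     graph_of 6 [(0,3), (0,4), (0,5), (1,4), (1,5), (2,5)],
     graph_of 6 [(0,3), (0,4), (0,5), (1,4), (2,5), (4,5)],
     graph_of 6 [(0,3), (0,4), (0,5), (1,4), (1,5), (2,5), (3,5)],
     graph_of 6 [(0,3), (0,4), (0,5), (1,4), (1,5), (2,5), (4,5)],
     graph_of 6 [(0,3), (0,4), (0,5), (1,4), (1,5), (2,5), (3,5), (4,5)],
     graph_of 6 [(0,3), (0,5), (1,4), (1,5), (2,4), (2,5), (4,5)],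
     graph_of 6 [(0,3), (0,4), (0,5), (1,4), (1,5), (2,4), (3,5), (4,5)],
     graph_of 6 [(0,2), (0,4), (0,5), (1,3), (1,4), (1,5), (2,4), (3,5)],
     graph_of 6 [(0,2), (0,4), (0,5), (1,3), (1,4), (1,5), (2,4), (3,5), (4,5)],
     graph_of 7 [(0,4), (0,6), (1,5), (1,6), (2,6), (3,6), (4,6), (5,6)],
     graph_of 7 [(0,4), (0,5), (0,6), (1,5), (1,6), (2,5), (2,6), (3,6), (4,5), (4,6)],
     graph_of 7 [(0,4), (0,5), (0,6), (1,5), (1,6), (2,5), (2,6), (3,6), (4,5), (4,6), (5,6)],
     graph_of 6 [(0,4), (1,4), (2,5), (3,5)],
     graph_of 6 [(0,3), (0,5), (1,4), (2,5)],
     graph_of 7 [(0,4), (1,5), (2,6), (3,6)],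
     graph_of 7 [(0,4), (0,6), (1,5), (2,6), (3,6), (4,6)],
     graph_of 7 [(0,4), (1,5), (1,6), (2,5), (2,6), (3,6), (5,6)],
     graph_of 8 [(0,4), (1,5), (2,6), (3,7)]
    ]"

end

theory Submission
  imports Defs
begin

text \<open>
  A run of the color change rule is recorded by its pairs \<open>(x, y)\<close>, where \<open>x\<close> forces \<open>y\<close>, and
  \<open>mz G\<close> is the maximal length of such a sequence. Hence a graph is minimal with \<open>mz > 3\<close> iff it has a
  sequence of length 4 and every sequence of length 4 meets all of its vertices. The vertices of a
  sequence of length 4 can coincide in only 15 ways, each of which determines 10 edges or non-edges.
  For each of them a decision tree branches on the remaining pairs until
  either a sequence of length 4 missing some vertex shows up, or the graph is one of the list.
\<close>

section \<open>Forcing sequences\<close>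

text \<open>The head of the list is the first force. Every vertex that the list does not force
  counts as blue from the start, so the vertices white before the first force are exactly the forced
  ones, and no blue set has to be carried along.\<close>

fun forces :: "'a graph \<Rightarrow> ('a \<times> 'a) list \<Rightarrow> bool" where
  "forces G [] \<longleftrightarrow> True"
| "forces G ((x, y) # ps) \<longleftrightarrow> {x, y} \<in> edges G
     \<and> (\<forall>y'\<in>snd ` set ps. {x, y'} \<notin> edges G \<and> x \<noteq> y' \<and> y \<noteq> y') \<and> forces G ps"

abbreviation support :: "('a \<times> 'a) list \<Rightarrow> 'a set" where
  "support ps \<equiv> fst ` set ps \<union> snd ` set ps"

lemma simple_graph_edgeD:
  assumes "simple_graph G" "{x, y} \<in> edges G"
  shows "x \<in> verts G" "y \<in> verts G" "x \<noteq> y"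
  using assms by (auto simp: simple_graph_def dest!: bspec)

text \<open>Leaving out the first forces amounts to starting with their targets already
  blue.\<close>

lemma forces_drop: "forces G ps \<Longrightarrow> forces G (drop n ps)"
proof (induction n arbitrary: ps)
  case (Suc n)
  then show ?case by (cases ps) auto
qed simp

lemma forces_distinct: "forces G ps \<Longrightarrow> distinct (map snd ps)"
  by (induction G ps rule: forces.induct) auto

lemma card_forced: "forces G ps \<Longrightarrow> card (snd ` set ps) = length ps"
  using distinct_card[OF forces_distinct] by fastforce

lemma support_subset_verts: "simple_graph G \<Longrightarrow> forces G ps \<Longrightarrow> support ps \<subseteq> verts G"
  by (induction G ps rule: forces.induct) (auto dest: simple_graph_edgeD)

text \<open>The white vertices are those forced now or later, and \<open>forces\<close> keeps the
  first forcing vertex non-adjacent to all of them but its own target.\<close>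

lemma forces_imp_forcing:
  assumes "simple_graph G" "forces G ps"
  shows "(force_step G)\<^sup>*\<^sup>* (verts G - snd ` set ps) (verts G)"
  using assms(2)
proof (induction ps)
  case (Cons p ps)
  obtain x y where p: "p = (x, y)" by fastforce
  let ?B = "verts G - snd ` set (p # ps)"
  have xy: "x \<in> verts G" "y \<in> verts G" "x \<noteq> y"
    using simple_graph_edgeD[OF assms(1)] Cons.prems p by auto
  have "x \<in> ?B" using Cons.prems p xy by auto
  moreover have "neighbors G x - ?B = {y}"
    using Cons.prems p simple_graph_edgeD[OF assms(1)] by (auto simp: neighbors_def)
  moreover have "verts G - snd ` set ps = insert y ?B"
    using Cons.prems p xy by auto
  ultimately have "force_step G ?B (verts G - snd ` set ps)"
    unfolding force_step_def by blast
  then show ?case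
    using Cons by (auto simp: p intro: converse_rtranclp_into_rtranclp)
qed simp

text \<open>The first step of the run is put in front of the sequence obtained for the rest; what is
  still white is then exactly what the sequence forces.\<close>

lemma forcing_imp_forces:
  assumes "(force_step G)\<^sup>*\<^sup>* B (verts G)" "simple_graph G" "B \<subseteq> verts G"
  shows "\<exists>ps. forces G ps \<and> snd ` set ps = verts G - B"
  using assms
proof (induction rule: converse_rtranclp_induct)
  case base
  show ?case by (intro exI[of _ "[]"]) auto
next
  case (step B B')
  then obtain x y where xy: "x \<in> B" "neighbors G x - B = {y}" "B' = insert y B"
    unfolding force_step_def by blast
  have edge: "{x, y} \<in> edges G" and "y \<notin> B"
    using xy(2) by (auto simp: neighbors_def)
  have "y \<in> verts G"
    using simple_graph_edgeD(2)[OF step.prems(1) edge] .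
  then obtain ps where ps: "forces G ps" "snd ` set ps = verts G - B'"
    using step.IH step.prems xy(3) by auto
  have "forces G ((x, y) # ps)"
    using xy edge ps by (auto simp: neighbors_def)
  moreover have "snd ` set ((x, y) # ps) = verts G - B"
    using \<open>y \<notin> B\<close> \<open>y \<in> verts G\<close> ps xy by auto
  ultimately show ?case by blast
qed

text \<open>Each initially white vertex is forced exactly once. So a minimum zero forcing set yields
  a sequence of length \<open>mz G\<close>, and a sequence of length \<open>k\<close> yields a zero
  forcing set with \<open>k\<close> vertices fewer than \<open>G\<close>.\<close>

lemma mz_ge_iff:
  assumes G: "simple_graph G"
  shows "k \<le> mz G \<longleftrightarrow> (\<exists>ps. forces G ps \<and> length ps = k)"
proof
  let ?P = "\<lambda>k. \<exists>B. zero_forcing_set G B \<and> card B = k"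
  have fin: "finite (verts G)" using G by (simp add: simple_graph_def)
  {
    assume k: "k \<le> mz G"
    have "zero_forcing_set G (verts G)" by (simp add: zero_forcing_set_def)
    then have "?P (zero_forcing_number G)"
      unfolding zero_forcing_number_def by (intro LeastI_ex[of ?P]) blast
    then obtain B where B: "zero_forcing_set G B" "card B = zero_forcing_number G" by blast
    then have "B \<subseteq> verts G" by (simp add: zero_forcing_set_def)
    obtain ps where ps: "forces G ps" "snd ` set ps = verts G - B"
      using forcing_imp_forces G B(1) by (metis zero_forcing_set_def)
    have "length ps = mz G"
      using card_forced[OF ps(1)] ps(2) B(2) card_Diff_subset[of B "verts G"] \<open>B \<subseteq> verts G\<close> fin
      by (auto simp: mz_def finite_subset)
    \<comment> \<open>The sequence of length \<open>mz G\<close> is cut down to length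
      \<open>k\<close> at its front.\<close>
    then show "\<exists>ps. forces G ps \<and> length ps = k"
      using forces_drop[OF ps(1), of "mz G - k"] k by (intro exI[of _ "drop (mz G - k) ps"]) simp
  next
    assume "\<exists>ps. forces G ps \<and> length ps = k"
    then obtain ps where ps: "forces G ps" "length ps = k" by blast
    let ?B = "verts G - snd ` set ps"
    have "?P (card ?B)"
      using forces_imp_forcing[OF G ps(1)] by (auto simp: zero_forcing_set_def)
    then have "zero_forcing_number G \<le> card ?B"
      unfolding zero_forcing_number_def by (rule Least_le)
    moreover have "snd ` set ps \<subseteq> verts G" using support_subset_verts[OF G ps(1)] by simp
    ultimately show "k \<le> mz G"
      using card_forced[OF ps(1)] ps(2) fin card_mono[of "verts G" "snd ` set ps"]
      by (auto simp: mz_def card_Diff_subset)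
  }
qed

section \<open>Minimality in terms of forcing sequences\<close>

lemma simple_graph_induced:
  "simple_graph G \<Longrightarrow> W \<subseteq> verts G \<Longrightarrow> simple_graph (induced G W)"
  by (auto simp: simple_graph_def induced_def finite_subset)

text \<open>All edges and non-edges that \<open>forces\<close> asks for join vertices of the
  support, and each vertex of the support lies on one of these edges.\<close>

lemma forces_induced_iff: "forces (induced G W) ps \<longleftrightarrow> forces G ps \<and> support ps \<subseteq> W"
  by (induction ps) (fastforce simp: induced_def)+

text \<open>A sequence of length \<open>Suc k\<close> that misses a vertex of \<open>G\<close>
  survives in a proper induced subgraph, which then has \<open>mz\<close> above
  \<open>k\<close>.\<close>

lemma Forb_mz_le_iff:
  "G \<in> Forb_mz_le k \<longleftrightarrow> simple_graph G \<and> (\<exists>ps. forces G ps \<and> length ps = Suc k)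
     \<and> (\<forall>ps. forces G ps \<and> length ps = Suc k \<longrightarrow> support ps = verts G)"
proof (cases "simple_graph G")
  case G: True
  have "mz (induced G W) \<le> k \<longleftrightarrow> (\<nexists>ps. forces G ps \<and> support ps \<subseteq> W \<and> length ps = Suc k)"
    if "W \<subset> verts G" for W
    using mz_ge_iff[OF simple_graph_induced[OF G], of W "Suc k"] that
    by (auto simp: forces_induced_iff not_less_eq_eq simp del: Un_subset_iff)
  then have "(\<forall>W. W \<subset> verts G \<longrightarrow> mz (induced G W) \<le> k) \<longleftrightarrow>
      (\<forall>W ps. W \<subset> verts G \<longrightarrow> \<not> (forces G ps \<and> support ps \<subseteq> W \<and> length ps = Suc k))"
    by simp
  \<comment> \<open>The critical choice of \<open>W\<close> is the support itself.\<close>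
  also have "\<dots> \<longleftrightarrow> (\<forall>ps. forces G ps \<and> length ps = Suc k \<longrightarrow> \<not> support ps \<subset> verts G)"
    by (meson order_refl order_le_less_trans)
  also have "\<dots> \<longleftrightarrow> (\<forall>ps. forces G ps \<and> length ps = Suc k \<longrightarrow> support ps = verts G)"
    using support_subset_verts[OF G] by (metis psubset_eq)
  finally have "(\<forall>W. W \<subset> verts G \<longrightarrow> mz (induced G W) \<le> k) \<longleftrightarrow>
      (\<forall>ps. forces G ps \<and> length ps = Suc k \<longrightarrow> support ps = verts G)" .
  then show ?thesis
    using G mz_ge_iff[OF G, of "Suc k"] by (simp add: Forb_mz_le_def Suc_le_eq)
qed (simp add: Forb_mz_le_def)

section \<open>Every minimal forbidden graph is listed\<close>

text \<open>The ways in which vertices of a forcing sequence can coincide, as pairs of the number of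
  vertices and the sequence of their indices. In front of a sequence, the forcing vertex is always new,
  and the forced vertex is new or one that forces later but is not forced later.\<close>

fun patterns :: "nat \<Rightarrow> (nat \<times> (nat \<times> nat) list) list" where
  "patterns 0 = [(0, [])]"
| "patterns (Suc k) = concat (map (\<lambda>(m, qs). (m + 2, (m, m + 1) # qs)
     # map (\<lambda>j. (m + 1, (m, j) # qs)) (filter (\<lambda>j. j \<notin> snd ` set qs) (map fst qs))) (patterns k))"

lemma patterns_Suc_iff:
  "p \<in> set (patterns (Suc k)) \<longleftrightarrow> (\<exists>(m, qs)\<in>set (patterns k). p = (m + 2, (m, m + 1) # qs)
     \<or> (\<exists>j\<in>fst ` set qs - snd ` set qs. p = (m + 1, (m, j) # qs)))"
  by (simp add: case_prod_beta image_iff Bex_def) blast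

abbreviation nth_pairs :: "'a list \<Rightarrow> (nat \<times> nat) list \<Rightarrow> ('a \<times> 'a) list" where
  "nth_pairs vs \<equiv> map (\<lambda>(i, j). (vs ! i, vs ! j))"

text \<open>Vertices are numbered as they enter when the sequence is built from its back, so
  \<open>vs\<close> grows only at its end and old indices keep their meaning.\<close>

lemma forces_pattern:
  assumes "simple_graph G" "forces G ps"
  shows "\<exists>qs vs. (length vs, qs) \<in> set (patterns (length ps)) \<and> distinct vs
    \<and> set vs = support ps \<and> support qs \<subseteq> {..<length vs} \<and> ps = nth_pairs vs qs"
  using assms(2)
proof (induction ps)
  case (Cons p ps)
  obtain x y where p: "p = (x, y)" by fastforce
  obtain qs vs where IH: "(length vs, qs) \<in> set (patterns (length ps))" "distinct vs"
      "set vs = support ps" "support qs \<subseteq> {..<length vs}" "ps = nth_pairs vs qs"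
    using Cons p by auto
  have qs_less: "i < length vs" "j < length vs" if "(i, j) \<in> set qs" for i j
    using IH(4) that by force+
  have "x \<noteq> y" using simple_graph_edgeD[OF assms(1)] Cons.prems p by auto
  have edges: "{a, b} \<in> edges G" if "(a, b) \<in> set ps" for a b
  proof -
    have "forces G ps" using Cons.prems p by simp
    then show ?thesis using that by (induction G ps rule: forces.induct) auto
  qed
  \<comment> \<open>A vertex that forces later is adjacent to its target, whereas \<open>x\<close>
    is adjacent to no vertex forced later and is none of them; so \<open>x\<close> is new.\<close>
  have x: "x \<notin> support ps"
    using Cons.prems edges by (force simp: p)
  have y: "y \<notin> snd ` set ps" using Cons.prems by (auto simp: p)
  show ?case
  \<comment> \<open>If \<open>y\<close> forces later, its index is reused; otherwise both
    \<open>x\<close> and \<open>y\<close> are appended.\<close>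
  proof (cases "y \<in> fst ` set ps")
    case True
    then obtain j where j: "j \<in> fst ` set qs" "y = vs ! j" using IH(5) by force
    then have j_less: "j < length vs" using qs_less by auto
    have "j \<notin> snd ` set qs"
      using y j(2) IH(5) by force
    let ?vs = "vs @ [x]" and ?qs = "(length vs, j) # qs"
    have "(length ?vs, ?qs) \<in> set (patterns (length (p # ps)))"
      using IH(1) j(1) \<open>j \<notin> snd ` set qs\<close> unfolding list.size(4) patterns_Suc_iff add_Suc_right add_0_right
      by (intro bexI[of _ "(length vs, qs)"]) simp_all
    moreover have "p # ps = nth_pairs ?vs ?qs"
      using IH(5) j j_less qs_less by (auto simp: p nth_append)
    moreover have "support ?qs \<subseteq> {..<length ?vs}" using IH(4) j_less by auto
    moreover have "distinct ?vs" "set ?vs = support (p # ps)"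
      using IH(2,3) x True p by auto
    ultimately show ?thesis
      by (intro exI[of _ ?qs] exI[of _ ?vs] conjI)
  next
    case False
    let ?vs = "vs @ [x, y]" and ?qs = "(length vs, length vs + 1) # qs"
    have "(length ?vs, ?qs) \<in> set (patterns (length (p # ps)))"
      using IH(1) unfolding list.size(4) patterns_Suc_iff add_Suc_right add_0_right
      by (intro bexI[of _ "(length vs, qs)"]) simp_all
    moreover have "p # ps = nth_pairs ?vs ?qs"
      using IH(5) qs_less by (auto simp: p nth_append)
    moreover have "support ?qs \<subseteq> {..<length ?vs}" using IH(4) by auto
    moreover have "distinct ?vs" "set ?vs = support (p # ps)"
      using IH(2,3) x y False \<open>x \<noteq> y\<close> p by auto
    ultimately show ?thesis
      by (intro exI[of _ ?qs] exI[of _ ?vs] conjI)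
  qed
qed simp

text \<open>\<open>Branch i j s t\<close> continues with \<open>s\<close> if \<open>i\<close> and \<open>j\<close> are adjacent, and with \<open>t\<close> otherwise.\<close>

datatype decision_tree =
    Branch nat nat decision_tree decision_tree
  | Forcing "(nat \<times> nat) list"
  | Listed nat "nat list"

text \<open>The lists hold ordered pairs that stand for unordered ones, hence both
  orientations.\<close>

definition known :: "('a \<times> 'a) list \<Rightarrow> 'a \<Rightarrow> 'a \<Rightarrow> bool" where
  "known ps a b \<longleftrightarrow> (a, b) \<in> set ps \<or> (b, a) \<in> set ps"

text \<open>This is \<open>forces\<close> for a partly known graph: adjacency must be settled by
  \<open>pos\<close> and non-adjacency by \<open>neg\<close>, so a positive answer holds in every
  graph that agrees with both.\<close>

fun known_forces :: "('a \<times> 'a) list \<Rightarrow> ('a \<times> 'a) list \<Rightarrow> ('a \<times> 'a) list \<Rightarrow> bool" where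
  "known_forces pos neg [] \<longleftrightarrow> True"
| "known_forces pos neg ((x, y) # qs) \<longleftrightarrow> known pos x y
     \<and> (\<forall>y'\<in>snd ` set qs. known neg x y' \<and> x \<noteq> y' \<and> y \<noteq> y') \<and> known_forces pos neg qs"

text \<open>\<open>pos\<close> and \<open>neg\<close> gather the decisions on the path from the
  root. A \<open>Forcing\<close> leaf exhibits a sequence missing a vertex; a \<open>Listed\<close>
  leaf needs every pair decided and sends index \<open>i\<close> to the vertex \<open>f ! i\<close>
  of the listed graph.\<close>

fun checks :: "nat \<Rightarrow> (nat \<times> nat) list \<Rightarrow> (nat \<times> nat) list \<Rightarrow> decision_tree \<Rightarrow> bool" where
  "checks n pos neg (Branch i j s t) \<longleftrightarrow> checks n ((i, j) # pos) neg s \<and> checks n pos ((i, j) # neg) t"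
| "checks n pos neg (Forcing qs) \<longleftrightarrow> length qs = 4 \<and> support qs \<subseteq> {..<n} \<and> card (support qs) < n
     \<and> known_forces pos neg qs"
| "checks n pos neg (Listed k f) \<longleftrightarrow> k < length listed_graphs \<and> length f = n \<and> distinct f
     \<and> support pos \<subseteq> {..<n} \<and> (\<forall>j<n. \<forall>i<j. known pos i j \<or> known neg i j)
     \<and> verts (listed_graphs ! k) = set f
     \<and> edges (listed_graphs ! k) = (\<lambda>(i, j). {f ! i, f ! j}) ` set pos"

section \<open>Soundness of the decision trees\<close>

lemma forces_nth_pairs:
  assumes "\<And>i j. (i, j) \<in> set pos \<Longrightarrow> {vs ! i, vs ! j} \<in> edges G"
    and "\<And>i j. (i, j) \<in> set neg \<Longrightarrow> {vs ! i, vs ! j} \<notin> edges G"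
    and "distinct vs" "support qs \<subseteq> {..<length vs}" "known_forces pos neg qs"
  shows "forces G (nth_pairs vs qs)"
  using assms(4,5)
proof (induction qs)
  case (Cons q qs)
  obtain x y where q: "q = (x, y)" by fastforce
  have pos: "known pos i j \<Longrightarrow> {vs ! i, vs ! j} \<in> edges G" for i j
    using assms(1)[of i j] assms(1)[of j i] by (auto simp: known_def insert_commute)
  have neg: "known neg i j \<Longrightarrow> {vs ! i, vs ! j} \<notin> edges G" for i j
    using assms(2)[of i j] assms(2)[of j i] by (auto simp: known_def insert_commute)
  show ?case
    using Cons assms(3) pos neg by (fastforce simp: q nth_eq_iff_index_eq)
qed simp

text \<open>Once every pair is decided, \<open>pos\<close> accounts for all edges of
  \<open>H\<close>, so matching \<open>vs\<close> with \<open>f\<close> position by position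
  preserves edges in both directions.\<close>

lemma graph_iso_nth:
  assumes "simple_graph H"
    and "\<And>i j. (i, j) \<in> set pos \<Longrightarrow> {vs ! i, vs ! j} \<in> edges H"
    and "\<And>i j. (i, j) \<in> set neg \<Longrightarrow> {vs ! i, vs ! j} \<notin> edges H"
    and vs: "distinct vs" "set vs = verts H"
    and f: "length f = length vs" "distinct f" "verts G = set f"
    and pos: "support pos \<subseteq> {..<length vs}"
    and complete: "\<And>i j. i < j \<Longrightarrow> j < length vs \<Longrightarrow> known pos i j \<or> known neg i j"
    and G: "edges G = (\<lambda>(i, j). {f ! i, f ! j}) ` set pos"
  shows "graph_iso H G"
proof -
  let ?n = "length vs"
  have bij_vs: "bij_betw ((!) vs) {..<?n} (verts H)"
    using vs by (intro bij_betw_nth) auto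
  have bij_f: "bij_betw ((!) f) {..<?n} (verts G)"
    using f by (intro bij_betw_nth) auto
  define h where "h = (!) f \<circ> the_inv_into {..<?n} ((!) vs)"
  have "bij_betw h (verts H) (verts G)"
    unfolding h_def using bij_betw_trans[OF bij_betw_the_inv_into[OF bij_vs] bij_f] .
  moreover have h: "h (vs ! i) = f ! i" if "i < ?n" for i
    using the_inv_into_f_f[OF bij_betw_imp_inj_on[OF bij_vs]] that by (simp add: h_def)
  have edge_iff: "{vs ! i, vs ! j} \<in> edges H \<longleftrightarrow> {f ! i, f ! j} \<in> edges G"
    if ij: "i < ?n" "j < ?n" for i j
  proof
    assume e: "{vs ! i, vs ! j} \<in> edges H"
    \<comment> \<open>\<open>complete\<close> speaks of \<open>i < j\<close> only; an edge has
      distinct ends, so the indices differ and one of the two orders applies.\<close>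
    then have "vs ! i \<noteq> vs ! j" using simple_graph_edgeD(3)[OF assms(1)] by blast
    then have "i < j \<or> j < i" by (metis linorder_neqE)
    then have "known pos i j \<or> known neg i j"
      using complete[of i j] complete[of j i] ij by (auto simp: known_def)
    moreover have "\<not> known neg i j"
      using e assms(3)[of i j] assms(3)[of j i] by (auto simp: known_def insert_commute)
    ultimately show "{f ! i, f ! j} \<in> edges G"
      unfolding G known_def by (force simp: insert_commute)
  next
    assume "{f ! i, f ! j} \<in> edges G"
    then obtain a b where ab: "(a, b) \<in> set pos" "{f ! i, f ! j} = {f ! a, f ! b}"
      unfolding G by auto
    then have "a < ?n" "b < ?n" using pos by force+
    \<comment> \<open>Distinctness of \<open>f\<close> recovers the indices from the
      vertices.\<close>
    then have "{i, j} = {a, b}"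
      using ab(2) ij f by (auto simp: doubleton_eq_iff nth_eq_iff_index_eq)
    then have "{vs ! i, vs ! j} = {vs ! a, vs ! b}" by (auto simp: doubleton_eq_iff)
    then show "{vs ! i, vs ! j} \<in> edges H" using assms(2)[OF ab(1)] by simp
  qed
  have "{x, y} \<in> edges H \<longleftrightarrow> {h x, h y} \<in> edges G" if xy: "x \<in> verts H" "y \<in> verts H" for x y
  proof -
    obtain i j where "i < ?n" "x = vs ! i" "j < ?n" "y = vs ! j"
      using xy vs(2) by (metis in_set_conv_nth)
    then show ?thesis using edge_iff h by simp
  qed
  ultimately show ?thesis unfolding graph_iso_def by blast
qed

text \<open>Induction on the tree, with the agreement of \<open>H\<close> with \<open>pos\<close>
  and \<open>neg\<close> as invariant. A branch is a case distinction on one pair, and a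
  \<open>Forcing\<close> leaf contradicts minimality.\<close>

lemma checks_sound:
  assumes H: "H \<in> Forb_mz_le 3"
    and vs: "distinct vs" "set vs = verts H"
    and "\<And>i j. (i, j) \<in> set pos \<Longrightarrow> {vs ! i, vs ! j} \<in> edges H"
    and "\<And>i j. (i, j) \<in> set neg \<Longrightarrow> {vs ! i, vs ! j} \<notin> edges H"
    and "checks (length vs) pos neg t"
  shows "\<exists>G\<in>set listed_graphs. graph_iso H G"
  using assms(4-)
proof (induction t arbitrary: pos neg)
  case (Branch i j s t)
  show ?case
  proof (cases "{vs ! i, vs ! j} \<in> edges H")
    case True
    then show ?thesis using Branch.prems by (intro Branch.IH(1)[of "(i, j) # pos" neg]) auto
  next
    case False
    then show ?thesis using Branch.prems by (intro Branch.IH(2)[of pos "(i, j) # neg"]) auto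
  qed
next
  case (Forcing qs)
  then have sub: "support qs \<subseteq> {..<length vs}" "card (support qs) < length vs"
    by simp_all
  have "forces H (nth_pairs vs qs)"
    using Forcing sub vs(1) by (intro forces_nth_pairs[of pos vs H neg]) auto
  \<comment> \<open>By minimality the sequence meets all vertices, although its support is too small
    for that.\<close>
  then have "support (nth_pairs vs qs) = set vs"
    using H Forcing.prems(3) unfolding Forb_mz_le_iff vs(2)
    by (simp del: set_map)
  moreover have "support (nth_pairs vs qs) = (!) vs ` support qs"
    by (simp add: image_Un image_image case_prod_beta)
  ultimately have "set vs = (!) vs ` support qs" by simp
  then have "card (set vs) \<le> card (support qs)" by (simp add: card_image_le)
  then show ?case using sub(2) vs(1) by (simp add: distinct_card)
next
  case (Listed k f)
  have "graph_iso H (listed_graphs ! k)"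
    using Listed H vs by (intro graph_iso_nth[of H pos vs neg f]) (auto simp: Forb_mz_le_iff)
  then show ?case using Listed.prems(3) by auto
qed

section \<open>The trees and the pairs decided at their roots\<close>

fun nonedges :: "('a \<times> 'a) list \<Rightarrow> ('a \<times> 'a) list" where
  "nonedges [] = []"
| "nonedges ((x, y) # ps) = map (\<lambda>(x', y'). (x, y')) ps @ nonedges ps"

lemma forces_edges: "forces G ps \<Longrightarrow> (x, y) \<in> set ps \<Longrightarrow> {x, y} \<in> edges G"
  by (induction G ps rule: forces.induct) auto

lemma forces_nonedges: "forces G ps \<Longrightarrow> (x, y) \<in> set (nonedges ps) \<Longrightarrow> {x, y} \<notin> edges G"
  by (induction G ps rule: forces.induct) force+

lemma nonedges_nth_pairs: "nonedges (nth_pairs vs qs) = nth_pairs vs (nonedges qs)"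
  by (induction qs rule: nonedges.induct) auto

text \<open>A pattern amounts to a partition of the four forces into forcing chains, hence 15
  entries. Each tree starts from 4 edges and 6 non-edges; for a single chain on 5 vertices these are
  all pairs, which gives \<open>P5\<close> without branching. Leaf numbers count from 0, so
  \<open>Listed 24\<close> is \<open>G25\<close>.\<close>

definition pattern_trees :: "(nat \<times> (nat \<times> nat) list \<times> decision_tree) list" where
  "pattern_trees = [
    (8, [(6, 7), (4, 5), (2, 3), (0, 1)],
      Branch 1 5 (Forcing [(1,5), (3,2), (5,4), (7,6)])
       (Branch 4 6 (Forcing [(1,0), (3,2), (5,4), (4,6)])
        (Branch 0 6 (Forcing [(1,0), (3,2), (5,4), (0,6)])
         (Branch 0 4 (Forcing [(1,0), (3,2), (0,4), (7,6)])
          (Branch 1 3 (Forcing [(1,3), (3,2), (5,4), (7,6)])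
           (Branch 0 3 (Forcing [(1,0), (0,3), (5,4), (7,6)])
            (Branch 2 6 (Forcing [(1,0), (3,2), (5,4), (2,6)])
             (Branch 3 5 (Forcing [(1,0), (3,5), (5,4), (7,6)])
              (Branch 3 7 (Forcing [(3,7), (1,0), (5,4), (7,6)])
               (Branch 2 4 (Forcing [(1,0), (3,2), (2,4), (7,6)])
                (Branch 0 5 (Forcing [(1,0), (0,5), (5,4), (7,6)])
                 (Branch 0 2 (Forcing [(1,0), (0,2), (5,4), (7,6)])
                  (Branch 2 7 (Forcing [(2,7), (1,0), (5,4), (7,6)])
                   (Branch 4 7 (Forcing [(4,7), (1,0), (3,2), (7,6)])
                    (Branch 0 7 (Forcing [(0,7), (3,2), (5,4), (7,6)])
                     (Branch 1 7 (Forcing [(1,7), (3,2), (5,4), (7,6)])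
                      (Branch 5 7 (Forcing [(1,0), (3,2), (5,7), (7,6)])
                       (Branch 2 5 (Forcing [(1,0), (2,5), (5,4), (7,6)])
                        (Listed 24 [0, 4, 1, 5, 2, 6, 3, 7]))))))))))))))))))),
    (7, [(6, 4), (4, 5), (2, 3), (0, 1)],
      Branch 1 5 (Forcing [(1,5), (3,2), (5,4), (4,6)])
       (Branch 3 5 (Forcing [(1,0), (3,5), (5,4), (4,6)])
        (Branch 1 3 (Forcing [(1,3), (3,2), (5,4), (4,6)])
         (Branch 0 3 (Forcing [(1,0), (5,4), (4,6), (0,3)])
          (Branch 0 4 (Branch 0 5 (Branch 2 6 (Forcing [(1,0), (6,2), (0,5), (2,3)])
             (Branch 0 6 (Branch 2 4 (Forcing [(1,0), (3,2), (2,4), (4,6)])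
               (Branch 2 5 (Forcing [(1,0), (2,5), (5,4), (4,6)])
                (Branch 0 2 (Forcing [(1,0), (5,4), (4,6), (0,2)])
                 (Listed 23 [6, 3, 0, 4, 5, 1, 2]))))
              (Forcing [(1,0), (3,2), (0,4), (4,6)])))
            (Forcing [(1,0), (3,2), (0,4), (4,5)]))
           (Branch 0 5 (Forcing [(1,0), (3,2), (0,5), (5,4)])
            (Branch 0 2 (Forcing [(0,2), (6,4), (4,5), (2,3)])
             (Branch 0 6 (Forcing [(1,0), (3,2), (0,6), (6,4)])
              (Branch 2 4 (Branch 2 5 (Branch 2 6 (Listed 23 [0, 4, 6, 3, 5, 1, 2])
                 (Forcing [(1,0), (3,2), (2,4), (4,6)]))
                (Forcing [(1,0), (3,2), (2,4), (4,5)]))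
               (Branch 2 5 (Forcing [(1,0), (3,2), (2,5), (5,4)])
                (Branch 2 6 (Forcing [(1,0), (3,2), (2,6), (6,4)])
                 (Listed 21 [0, 4, 1, 5, 6, 2, 3])))))))))))),
    (7, [(6, 2), (4, 5), (2, 3), (0, 1)],
      Branch 1 5 (Forcing [(1,5), (3,2), (5,4), (2,6)])
       (Branch 1 3 (Forcing [(1,3), (3,2), (5,4), (2,6)])
        (Branch 0 3 (Branch 4 6 (Forcing [(1,0), (6,4), (4,5), (0,3)])
          (Branch 0 4 (Branch 2 4 (Branch 0 5 (Branch 0 6 (Branch 2 5 (Branch 3 5 (Forcing [(1,0), (3,5), (5,4), (0,6)])
                (Branch 0 2 (Listed 18 [6, 3, 5, 1, 0, 4, 2])
                 (Listed 17 [6, 3, 5, 1, 0, 4, 2])))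
               (Forcing [(1,0), (5,4), (4,2), (2,6)]))
              (Forcing [(1,0), (3,2), (0,4), (2,6)]))
             (Forcing [(1,0), (6,2), (0,4), (4,5)]))
            (Forcing [(1,0), (3,2), (2,6), (0,4)]))
           (Branch 0 5 (Forcing [(1,0), (6,2), (0,5), (5,4)])
            (Branch 3 5 (Forcing [(1,0), (6,2), (0,3), (3,5)])
             (Branch 0 2 (Branch 2 4 (Forcing [(1,0), (6,2), (0,3), (2,4)])
               (Branch 2 5 (Forcing [(1,0), (3,2), (2,5), (5,4)])
                (Branch 0 6 (Listed 23 [6, 3, 5, 1, 0, 4, 2])
                 (Forcing [(1,0), (0,2), (5,4), (2,6)]))))
              (Forcing [(1,0), (0,3), (3,2), (5,4)]))))))
         (Branch 0 5 (Forcing [(1,0), (6,2), (0,5), (2,3)])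
          (Branch 0 4 (Forcing [(1,0), (0,4), (4,5), (2,3)])
           (Branch 0 2 (Forcing [(1,0), (0,2), (4,5), (2,3)])
            (Branch 0 6 (Forcing [(0,6), (6,2), (4,5), (2,3)])
             (Branch 2 4 (Branch 3 5 (Branch 2 5 (Branch 4 6 (Forcing [(1,0), (3,5), (5,4), (4,6)])
                 (Listed 23 [0, 4, 6, 1, 2, 5, 3]))
                (Forcing [(1,0), (5,3), (3,2), (2,6)]))
               (Branch 2 5 (Branch 4 6 (Listed 23 [0, 4, 6, 3, 5, 1, 2])
                 (Listed 22 [1, 5, 6, 2, 0, 4, 3]))
                (Forcing [(1,0), (3,2), (2,4), (4,5)])))
              (Branch 4 6 (Forcing [(1,0), (3,2), (2,6), (6,4)])
               (Branch 2 5 (Forcing [(1,0), (4,5), (5,2), (2,6)])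
                (Branch 3 5 (Forcing [(1,0), (5,3), (3,2), (2,6)])
                 (Listed 21 [0, 4, 6, 2, 1, 5, 3])))))))))))),
    (7, [(6, 0), (4, 5), (2, 3), (0, 1)],
      Branch 1 5 (Branch 4 6 (Forcing [(1,5), (3,2), (5,4), (4,6)])
        (Branch 2 6 (Forcing [(1,5), (3,2), (5,4), (2,6)])
         (Branch 2 4 (Forcing [(1,0), (3,2), (2,4), (0,6)])
          (Branch 0 2 (Branch 0 3 (Branch 3 5 (Branch 2 5 (Branch 0 4 (Branch 1 3 (Forcing [(4,0), (1,3), (3,2), (0,6)])
                (Branch 0 5 (Listed 18 [6, 1, 0, 4, 2, 5, 3])
                 (Listed 17 [6, 1, 0, 4, 2, 5, 3])))
               (Forcing [(4,5), (1,0), (5,2), (0,6)]))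
              (Forcing [(2,3), (3,5), (5,4), (0,6)]))
             (Forcing [(3,0), (1,5), (5,4), (0,6)]))
            (Forcing [(3,2), (2,0), (5,4), (0,6)]))
           (Branch 0 3 (Forcing [(2,3), (3,0), (5,4), (0,6)])
            (Branch 3 5 (Forcing [(3,5), (1,0), (5,4), (0,6)])
             (Branch 0 5 (Branch 0 4 (Branch 2 5 (Forcing [(2,5), (1,0), (5,4), (0,6)])
                (Branch 1 3 (Forcing [(3,1), (1,0), (5,4), (0,6)])
                 (Listed 23 [6, 1, 0, 4, 2, 5, 3])))
               (Forcing [(3,2), (4,5), (5,0), (0,6)]))
              (Forcing [(2,3), (5,1), (1,0), (0,6)]))))))))
       (Branch 3 5 (Forcing [(1,0), (3,5), (5,4), (0,6)])
        (Branch 2 6 (Branch 1 3 (Forcing [(1,3), (3,2), (5,4), (2,6)])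
          (Branch 0 5 (Branch 0 3 (Branch 4 6 (Forcing [(1,0), (5,4), (4,6), (0,3)])
             (Branch 2 5 (Branch 2 4 (Branch 0 4 (Branch 0 2 (Listed 18 [6, 3, 5, 1, 0, 4, 2])
                 (Listed 17 [6, 3, 5, 1, 0, 4, 2]))
                (Forcing [(1,0), (3,2), (0,6), (2,4)]))
               (Forcing [(1,0), (3,2), (2,5), (5,4)]))
              (Forcing [(1,0), (3,2), (2,6), (0,5)])))
            (Forcing [(1,0), (6,2), (0,5), (2,3)]))
           (Branch 0 4 (Forcing [(1,0), (3,2), (0,4), (4,5)])
            (Branch 4 6 (Forcing [(1,0), (3,2), (0,6), (6,4)])
             (Branch 2 5 (Forcing [(1,0), (3,2), (0,6), (2,5)])
              (Branch 0 2 (Branch 2 4 (Forcing [(1,0), (3,2), (0,6), (2,4)])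
                (Branch 0 3 (Listed 23 [6, 3, 5, 1, 0, 4, 2])
                 (Forcing [(1,0), (0,2), (2,3), (5,4)])))
               (Forcing [(1,0), (5,4), (0,6), (6,2)])))))))
         (Branch 2 5 (Forcing [(1,0), (3,2), (2,5), (0,6)])
          (Branch 2 4 (Forcing [(1,0), (3,2), (2,4), (0,6)])
           (Branch 0 2 (Branch 0 3 (Branch 4 6 (Forcing [(1,0), (5,4), (4,6), (0,2)])
              (Branch 0 4 (Branch 0 5 (Branch 1 3 (Forcing [(4,0), (1,3), (3,2), (0,6)])
                 (Listed 16 [6, 2, 0, 4, 1, 5, 3]))
                (Forcing [(1,0), (3,2), (0,4), (4,5)]))
               (Branch 0 5 (Forcing [(1,0), (3,2), (0,5), (5,4)])
                (Branch 1 3 (Listed 23 [6, 1, 2, 5, 0, 4, 3])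
                 (Listed 22 [6, 2, 0, 4, 1, 5, 3])))))
             (Forcing [(3,2), (2,0), (5,4), (0,6)]))
            (Branch 0 3 (Forcing [(2,3), (3,0), (5,4), (0,6)])
             (Branch 1 3 (Forcing [(3,1), (1,0), (5,4), (0,6)])
              (Branch 0 4 (Branch 0 5 (Branch 4 6 (Listed 23 [6, 3, 0, 4, 5, 1, 2])
                 (Listed 22 [6, 2, 1, 5, 0, 4, 3]))
                (Forcing [(1,0), (3,2), (0,4), (4,5)]))
               (Branch 4 6 (Forcing [(1,0), (3,2), (0,6), (6,4)])
                (Branch 0 5 (Forcing [(1,0), (0,5), (3,2), (5,4)])
                 (Listed 21 [6, 2, 0, 4, 1, 5, 3])))))))))))),
    (7, [(5, 6), (4, 2), (2, 3), (0, 1)],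
      Branch 0 5 (Forcing [(1,0), (3,2), (2,4), (0,5)])
       (Branch 1 6 (Forcing [(1,6), (3,2), (2,4), (6,5)])
        (Branch 4 5 (Forcing [(1,0), (3,2), (2,4), (4,5)])
         (Branch 1 3 (Forcing [(1,3), (3,2), (2,4), (6,5)])
          (Branch 0 2 (Branch 0 3 (Branch 4 6 (Forcing [(1,0), (4,6), (0,3), (6,5)])
             (Branch 2 6 (Forcing [(1,0), (4,2), (2,6), (6,5)])
              (Branch 0 4 (Branch 0 6 (Forcing [(1,0), (2,4), (0,6), (6,5)])
                (Branch 3 6 (Forcing [(1,0), (2,3), (3,6), (6,5)])
                 (Listed 23 [6, 3, 5, 1, 2, 0, 4])))
               (Forcing [(1,0), (0,2), (2,4), (6,5)]))))
            (Forcing [(1,0), (0,2), (2,3), (6,5)]))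
           (Branch 0 3 (Forcing [(1,0), (0,3), (3,2), (6,5)])
            (Branch 0 4 (Forcing [(1,0), (0,4), (4,2), (2,3)])
             (Branch 0 6 (Forcing [(0,6), (3,2), (2,4), (6,5)])
              (Branch 2 6 (Branch 3 6 (Branch 4 6 (Listed 23 [0, 4, 5, 1, 2, 3, 6])
                 (Forcing [(1,0), (4,2), (2,6), (6,5)]))
                (Forcing [(1,0), (3,2), (2,6), (6,5)]))
               (Branch 4 6 (Forcing [(1,0), (2,4), (4,6), (6,5)])
                (Branch 3 6 (Forcing [(1,0), (2,3), (3,6), (6,5)])
                 (Listed 21 [0, 4, 6, 2, 3, 1, 5])))))))))))),
    (6, [(5, 4), (4, 2), (2, 3), (0, 1)],
      Branch 1 3 (Forcing [(1,3), (3,2), (2,4), (4,5)])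
       (Branch 0 2 (Branch 0 4 (Branch 0 3 (Branch 0 5 (Listed 11 [5, 2, 0, 3, 4, 1])
           (Listed 10 [5, 2, 4, 1, 0, 3]))
          (Branch 0 5 (Listed 10 [5, 2, 0, 3, 4, 1])
           (Listed 8 [0, 3, 4, 1, 5, 2])))
         (Branch 0 5 (Branch 0 3 (Listed 9 [5, 2, 0, 3, 4, 1])
           (Listed 7 [0, 3, 5, 2, 1, 4]))
          (Forcing [(1,0), (0,2), (2,4), (4,5)])))
        (Branch 0 3 (Branch 0 4 (Branch 0 5 (Listed 9 [5, 2, 4, 1, 0, 3])
           (Listed 7 [0, 3, 1, 4, 5, 2]))
          (Forcing [(1,0), (0,3), (3,2), (2,4)]))
         (Branch 0 4 (Forcing [(1,0), (0,4), (4,2), (2,3)])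
          (Branch 0 5 (Forcing [(1,0), (0,5), (5,4), (4,2)])
           (Listed 20 [1, 4, 0, 3, 5, 2])))))),
    (6, [(5, 0), (4, 2), (2, 3), (0, 1)],
      Branch 1 3 (Branch 4 5 (Forcing [(1,3), (3,2), (2,4), (4,5)])
        (Branch 0 2 (Branch 0 3 (Branch 0 4 (Listed 11 [5, 1, 0, 4, 3, 2])
           (Listed 10 [5, 1, 0, 4, 3, 2]))
          (Branch 0 4 (Listed 9 [5, 1, 0, 4, 3, 2])
           (Listed 7 [0, 4, 5, 1, 2, 3])))
         (Branch 0 3 (Branch 0 4 (Listed 9 [5, 3, 4, 0, 1, 2])
           (Forcing [(4,2), (2,3), (3,0), (0,5)]))
          (Forcing [(2,3), (3,1), (1,0), (0,5)]))))
       (Branch 0 2 (Branch 0 3 (Branch 0 4 (Branch 4 5 (Listed 11 [5, 2, 0, 3, 4, 1])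
           (Listed 4 [5, 2, 4, 0, 1, 3]))
          (Branch 4 5 (Listed 9 [5, 2, 0, 3, 4, 1])
           (Listed 3 [5, 2, 4, 0, 1, 3])))
         (Branch 0 4 (Branch 4 5 (Listed 10 [5, 2, 0, 3, 4, 1])
           (Listed 3 [5, 2, 4, 1, 0, 3]))
          (Branch 4 5 (Listed 7 [0, 3, 5, 2, 1, 4])
           (Listed 1 [4, 0, 5, 2, 3, 1]))))
        (Branch 0 3 (Branch 0 4 (Branch 4 5 (Listed 9 [5, 2, 4, 1, 0, 3])
           (Listed 2 [5, 2, 4, 0, 1, 3]))
          (Forcing [(1,0), (0,3), (3,2), (2,4)]))
         (Branch 0 4 (Forcing [(1,0), (0,4), (4,2), (2,3)])
          (Branch 4 5 (Forcing [(1,0), (0,5), (5,4), (4,2)])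
           (Listed 19 [4, 0, 5, 2, 3, 1])))))),
    (7, [(5, 6), (4, 0), (2, 3), (0, 1)],
      Branch 2 5 (Forcing [(1,0), (3,2), (0,4), (2,5)])
       (Branch 4 5 (Forcing [(1,0), (3,2), (0,4), (4,5)])
        (Branch 1 6 (Branch 2 4 (Forcing [(1,6), (3,2), (2,4), (6,5)])
          (Branch 0 2 (Branch 0 3 (Branch 2 6 (Branch 4 6 (Branch 3 6 (Branch 1 3 (Forcing [(4,6), (1,3), (3,2), (6,5)])
                (Branch 0 6 (Listed 18 [5, 1, 0, 4, 2, 3, 6])
                 (Listed 17 [5, 1, 0, 4, 2, 3, 6])))
               (Forcing [(3,0), (1,6), (0,4), (6,5)]))
              (Forcing [(4,0), (2,6), (0,1), (6,5)]))
             (Forcing [(2,0), (1,6), (0,4), (6,5)]))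
            (Forcing [(3,2), (2,0), (0,4), (6,5)]))
           (Branch 0 3 (Forcing [(2,3), (3,0), (0,4), (6,5)])
            (Branch 2 6 (Forcing [(2,6), (1,0), (0,4), (6,5)])
             (Branch 0 6 (Branch 1 3 (Forcing [(3,1), (1,0), (0,4), (6,5)])
               (Branch 4 6 (Branch 3 6 (Forcing [(3,6), (1,0), (0,4), (6,5)])
                 (Listed 23 [5, 1, 0, 4, 2, 3, 6]))
                (Forcing [(4,0), (0,6), (2,3), (6,5)])))
              (Forcing [(0,1), (1,6), (3,2), (6,5)]))))))
         (Branch 3 6 (Forcing [(1,0), (3,6), (0,4), (6,5)])
          (Branch 0 6 (Forcing [(1,0), (3,2), (0,6), (6,5)])
           (Branch 2 6 (Forcing [(1,0), (0,4), (2,6), (6,5)])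
            (Branch 4 6 (Forcing [(1,0), (0,4), (4,6), (6,5)])
             (Branch 0 2 (Branch 1 3 (Branch 2 4 (Forcing [(1,3), (3,2), (2,4), (6,5)])
                (Branch 0 3 (Listed 23 [6, 1, 2, 5, 3, 0, 4])
                 (Forcing [(3,1), (1,0), (0,4), (6,5)])))
               (Branch 0 3 (Branch 2 4 (Listed 23 [6, 3, 5, 1, 2, 0, 4])
                 (Listed 22 [6, 2, 0, 4, 3, 1, 5]))
                (Forcing [(1,0), (0,2), (2,3), (6,5)])))
              (Branch 2 4 (Forcing [(1,0), (0,4), (4,2), (6,5)])
               (Branch 0 3 (Forcing [(2,3), (3,0), (0,4), (6,5)])
                (Branch 1 3 (Forcing [(3,1), (1,0), (0,4), (6,5)])
                 (Listed 21 [6, 2, 0, 4, 3, 1, 5])))))))))))),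
    (6, [(5, 4), (4, 0), (2, 3), (0, 1)],
      Branch 0 3 (Branch 2 5 (Branch 1 3 (Branch 2 4 (Branch 0 2 (Listed 15 [4, 2, 5, 0, 1, 3])
           (Listed 14 [0, 2, 1, 4, 5, 3]))
          (Forcing [(1,3), (3,2), (2,5), (5,4)]))
         (Branch 0 2 (Branch 2 4 (Listed 13 [4, 2, 5, 1, 0, 3])
           (Listed 9 [5, 2, 0, 3, 1, 4]))
          (Forcing [(1,0), (0,3), (3,2), (2,5)])))
        (Branch 2 4 (Branch 1 3 (Forcing [(1,3), (3,2), (2,4), (4,5)])
          (Branch 0 2 (Listed 10 [5, 2, 4, 1, 0, 3])
           (Listed 7 [0, 3, 1, 4, 5, 2])))
         (Branch 0 2 (Branch 1 3 (Listed 12 [5, 1, 2, 4, 0, 3])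
           (Listed 6 [5, 2, 0, 3, 1, 4]))
          (Forcing [(2,3), (3,0), (0,4), (4,5)]))))
       (Branch 1 3 (Forcing [(3,1), (1,0), (0,4), (4,5)])
        (Branch 0 2 (Branch 2 4 (Branch 2 5 (Listed 10 [0, 3, 5, 2, 4, 1])
           (Listed 8 [0, 3, 4, 1, 5, 2]))
          (Branch 2 5 (Listed 7 [0, 3, 5, 2, 4, 1])
           (Forcing [(3,2), (2,0), (0,4), (4,5)])))
         (Branch 2 4 (Forcing [(1,0), (0,4), (4,2), (2,3)])
          (Branch 2 5 (Forcing [(1,0), (0,4), (4,5), (5,2)])
           (Listed 20 [0, 3, 1, 4, 5, 2])))))),
    (6, [(5, 2), (4, 0), (2, 3), (0, 1)],
      Branch 0 3 (Branch 1 3 (Branch 2 4 (Branch 0 2 (Branch 4 5 (Listed 15 [4, 2, 5, 0, 1, 3])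
           (Listed 13 [5, 3, 4, 0, 1, 2]))
          (Branch 4 5 (Listed 14 [0, 2, 1, 4, 5, 3])
           (Forcing [(1,0), (0,4), (4,2), (2,5)])))
         (Branch 4 5 (Forcing [(1,3), (3,2), (2,5), (5,4)])
          (Branch 0 2 (Listed 10 [5, 1, 0, 4, 2, 3])
           (Forcing [(4,0), (0,3), (3,2), (2,5)]))))
        (Branch 0 2 (Branch 2 4 (Branch 4 5 (Listed 13 [4, 2, 5, 1, 0, 3])
           (Listed 5 [4, 2, 5, 0, 1, 3]))
          (Branch 4 5 (Listed 9 [5, 2, 0, 3, 1, 4])
           (Listed 3 [5, 2, 4, 0, 3, 1])))
         (Forcing [(1,0), (0,3), (3,2), (2,5)])))
       (Branch 0 2 (Branch 1 3 (Branch 4 5 (Forcing [(3,1), (1,0), (0,4), (4,5)])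
          (Branch 2 4 (Listed 9 [0, 4, 5, 1, 3, 2])
           (Listed 7 [0, 4, 5, 1, 3, 2])))
         (Branch 2 4 (Branch 4 5 (Listed 10 [0, 3, 5, 2, 4, 1])
           (Listed 3 [4, 1, 5, 2, 0, 3]))
          (Branch 4 5 (Listed 7 [0, 3, 5, 2, 4, 1])
           (Listed 1 [4, 0, 5, 2, 1, 3]))))
        (Branch 1 3 (Forcing [(0,1), (1,3), (3,2), (2,5)])
         (Branch 2 4 (Forcing [(1,0), (0,4), (4,2), (2,3)])
          (Branch 4 5 (Forcing [(1,0), (0,4), (4,5), (5,2)])
           (Listed 19 [4, 0, 5, 2, 1, 3])))))),
    (7, [(5, 6), (3, 4), (2, 0), (0, 1)],
      Branch 2 5 (Forcing [(1,0), (0,2), (4,3), (2,5)])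
       (Branch 3 5 (Forcing [(1,0), (0,2), (4,3), (3,5)])
        (Branch 2 3 (Forcing [(1,0), (0,2), (2,3), (6,5)])
         (Branch 3 6 (Forcing [(3,6), (1,0), (0,2), (6,5)])
          (Branch 0 4 (Branch 2 4 (Branch 1 6 (Forcing [(3,4), (1,6), (4,2), (6,5)])
             (Branch 4 6 (Forcing [(3,4), (1,0), (4,6), (6,5)])
              (Branch 1 4 (Branch 0 6 (Forcing [(1,0), (0,6), (4,3), (6,5)])
                (Branch 2 6 (Forcing [(0,2), (2,6), (4,3), (6,5)])
                 (Listed 23 [5, 1, 2, 3, 6, 0, 4])))
               (Forcing [(1,0), (0,4), (4,3), (6,5)]))))
            (Forcing [(2,0), (0,4), (4,3), (6,5)]))
           (Branch 4 6 (Forcing [(3,4), (4,6), (1,0), (6,5)])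
            (Branch 1 4 (Forcing [(0,1), (1,4), (4,3), (6,5)])
             (Branch 2 4 (Forcing [(0,2), (2,4), (4,3), (6,5)])
              (Branch 0 6 (Branch 2 6 (Branch 1 6 (Listed 23 [5, 1, 2, 0, 4, 3, 6])
                 (Forcing [(1,0), (0,6), (4,3), (6,5)]))
                (Forcing [(2,0), (0,6), (4,3), (6,5)]))
               (Branch 2 6 (Forcing [(0,2), (2,6), (4,3), (6,5)])
                (Branch 1 6 (Forcing [(0,1), (1,6), (4,3), (6,5)])
                 (Listed 21 [6, 2, 3, 0, 4, 1, 5])))))))))))),
    (6, [(5, 3), (3, 4), (2, 0), (0, 1)],
      Branch 0 4 (Branch 1 4 (Branch 2 3 (Branch 2 5 (Branch 2 4 (Listed 15 [0, 2, 5, 1, 4, 3])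
           (Listed 14 [0, 2, 5, 1, 4, 3]))
          (Forcing [(1,0), (0,2), (2,3), (3,5)]))
         (Branch 2 5 (Forcing [(1,0), (0,2), (2,5), (5,3)])
          (Branch 2 4 (Listed 12 [4, 1, 2, 0, 5, 3])
           (Forcing [(2,0), (0,4), (4,3), (3,5)]))))
        (Forcing [(1,0), (0,4), (4,3), (3,5)]))
       (Branch 1 4 (Forcing [(0,1), (1,4), (4,3), (3,5)])
        (Branch 2 3 (Branch 2 5 (Branch 2 4 (Listed 12 [0, 3, 5, 4, 1, 2])
           (Forcing [(1,0), (0,2), (2,3), (3,4)]))
          (Forcing [(1,0), (0,2), (2,3), (3,5)]))
         (Branch 2 5 (Forcing [(1,0), (0,2), (2,5), (5,3)])
          (Branch 2 4 (Forcing [(0,2), (2,4), (4,3), (3,5)])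
           (Listed 19 [4, 0, 1, 5, 2, 3])))))),
    (6, [(5, 2), (3, 4), (2, 0), (0, 1)],
      Branch 2 3 (Branch 1 4 (Branch 3 5 (Branch 0 4 (Branch 2 4 (Listed 15 [0, 2, 5, 1, 4, 3])
           (Listed 14 [0, 2, 5, 1, 4, 3]))
          (Forcing [(0,1), (1,4), (4,3), (3,5)]))
         (Branch 2 4 (Branch 0 4 (Listed 13 [0, 3, 4, 1, 5, 2])
           (Listed 9 [1, 4, 5, 3, 0, 2]))
          (Forcing [(1,4), (4,3), (3,2), (2,5)])))
        (Branch 0 4 (Branch 3 5 (Forcing [(1,0), (0,4), (4,3), (3,5)])
          (Branch 2 4 (Listed 10 [0, 3, 5, 1, 4, 2])
           (Listed 7 [0, 3, 5, 1, 4, 2])))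
         (Branch 2 4 (Branch 3 5 (Listed 12 [0, 3, 5, 4, 1, 2])
           (Listed 6 [1, 4, 5, 0, 3, 2]))
          (Forcing [(1,0), (0,2), (2,3), (3,4)]))))
       (Branch 3 5 (Forcing [(1,0), (0,2), (2,5), (5,3)])
        (Branch 0 4 (Branch 2 4 (Branch 1 4 (Listed 10 [4, 1, 0, 2, 5, 3])
           (Listed 8 [0, 3, 5, 1, 4, 2]))
          (Forcing [(3,4), (4,0), (0,2), (2,5)]))
         (Branch 1 4 (Branch 2 4 (Listed 7 [4, 1, 0, 2, 5, 3])
           (Forcing [(4,1), (1,0), (0,2), (2,5)]))
          (Branch 2 4 (Forcing [(1,0), (0,2), (2,4), (4,3)])
           (Listed 20 [0, 3, 5, 1, 4, 2])))))),
    (6, [(4, 5), (3, 2), (2, 0), (0, 1)],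
      Branch 3 4 (Forcing [(1,0), (0,2), (2,3), (3,4)])
       (Branch 0 5 (Branch 2 5 (Branch 1 5 (Branch 3 5 (Listed 11 [0, 3, 4, 1, 2, 5])
           (Listed 10 [4, 1, 0, 3, 2, 5]))
          (Branch 3 5 (Listed 10 [0, 3, 4, 1, 2, 5])
           (Listed 8 [0, 3, 4, 1, 2, 5])))
         (Branch 3 5 (Branch 1 5 (Listed 9 [0, 3, 4, 1, 2, 5])
           (Listed 7 [0, 3, 4, 1, 2, 5]))
          (Forcing [(3,2), (2,0), (0,5), (5,4)])))
        (Branch 1 5 (Branch 2 5 (Branch 3 5 (Listed 9 [4, 1, 0, 3, 2, 5])
           (Listed 7 [4, 1, 0, 3, 2, 5]))
          (Forcing [(2,0), (0,1), (1,5), (5,4)]))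
         (Branch 2 5 (Forcing [(1,0), (0,2), (2,5), (5,4)])
          (Branch 3 5 (Forcing [(0,2), (2,3), (3,5), (5,4)])
           (Listed 20 [0, 3, 5, 2, 1, 4])))))),
    (5, [(4, 3), (3, 2), (2, 0), (0, 1)],
      Listed 0 [0, 2, 4, 1, 3])]"

text \<open>This is the completeness of the case list: no pattern lacks a tree.\<close>

lemma patterns_eq: "patterns 4 = map (\<lambda>(n, qs, t). (n, qs)) pattern_trees"
  unfolding pattern_trees_def list.map case_prod_conv by code_simp

lemma pattern_trees_check: "\<forall>(n, qs, t)\<in>set pattern_trees. checks n qs (nonedges qs) t"
  unfolding pattern_trees_def list.set ball_simps case_prod_conv
  by (intro conjI TrueI; code_simp)

text \<open>Minimality enters twice: it makes \<open>vs\<close> enumerate all of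
  \<open>verts H\<close>, and it refutes the \<open>Forcing\<close> leaves.\<close>

lemma Forb_3_listed:
  assumes "H \<in> Forb_mz_le 3"
  shows "\<exists>G\<in>set listed_graphs. graph_iso H G"
proof -
  obtain ps where ps: "forces H ps" "length ps = 4" "support ps = verts H"
    using assms by (auto simp: Forb_mz_le_iff)
  obtain qs vs where vs: "(length vs, qs) \<in> set (patterns 4)" "distinct vs"
      "set vs = verts H" "ps = nth_pairs vs qs"
    using forces_pattern[OF _ ps(1)] assms ps by (auto simp: Forb_mz_le_def)
  obtain t where t: "checks (length vs) qs (nonedges qs) t"
    using pattern_trees_check vs(1) unfolding patterns_eq by fastforce
  show ?thesis
  proof (rule checks_sound[OF assms vs(2,3) _ _ t])
    show "{vs ! i, vs ! j} \<in> edges H" if "(i, j) \<in> set qs" for i j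
      using that by (intro forces_edges[OF ps(1)]) (force simp: vs(4))
    show "{vs ! i, vs ! j} \<notin> edges H" if "(i, j) \<in> set (nonedges qs)" for i j
      using that by (intro forces_nonedges[OF ps(1)]) (force simp: vs(4) nonedges_nth_pairs)
  qed
qed

section \<open>The listed graphs are minimal forbidden\<close>

lemma edges_graph_of: "{a, b} \<in> edges (graph_of n es) \<longleftrightarrow> known es a b"
  by (simp add: graph_of_def known_def image_iff Bex_def split_paired_Ex doubleton_eq_iff) blast

text \<open>The pair given second is the one that is to force earlier.\<close>

fun compatible :: "(nat \<times> nat) list \<Rightarrow> nat \<times> nat \<Rightarrow> nat \<times> nat \<Rightarrow> bool" where
  "compatible es (x', y') (x, y) \<longleftrightarrow> x \<noteq> y' \<and> y \<noteq> y' \<and> \<not> known es x y'"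

text \<open>\<open>forces\<close> consists of conditions on single forces and on two forces at a
  time, so the candidates in front of \<open>p # ps\<close> are those in front of \<open>ps\<close>
  that tolerate \<open>p\<close>.\<close>

lemma candidates_Cons:
  assumes "set cs = {p. forces (graph_of n es) (p # ps)}" "p \<in> set cs"
  shows "set (filter (compatible es p) cs) = {q. forces (graph_of n es) (q # p # ps)}"
  using assms by (cases p) (auto simp: edges_graph_of)

lemma candidates_Nil: "set (es @ map prod.swap es) = {p. forces (graph_of n es) [p]}"
  by (force simp: edges_graph_of known_def)

text \<open>Both searches extend a forcing sequence \<open>ps\<close> by \<open>k\<close> pairs at its front. The candidates \<open>cs\<close> for the
  next pair are computed incrementally, and the recursion is on lists of candidates instead of using a
  quantifier because \<open>code_simp\<close> would unfold the recursive call under the binder.\<close>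

fun all_cover :: "nat \<Rightarrow> (nat \<times> nat) list \<Rightarrow> nat \<Rightarrow> (nat \<times> nat) list \<Rightarrow> (nat \<times> nat) list \<Rightarrow> bool"
  and each_covers :: "nat \<Rightarrow> (nat \<times> nat) list \<Rightarrow> nat \<Rightarrow> (nat \<times> nat) list \<Rightarrow> (nat \<times> nat) list
    \<Rightarrow> (nat \<times> nat) list \<Rightarrow> bool" where
  "all_cover n es 0 ps cs \<longleftrightarrow> {..<n} \<subseteq> support ps"
| "all_cover n es (Suc k) ps cs \<longleftrightarrow> each_covers n es k ps cs cs"
| "each_covers n es k ps cs [] \<longleftrightarrow> True"
| "each_covers n es k ps cs (p # todo) \<longleftrightarrow>
     all_cover n es k (p # ps) (filter (compatible es p) cs) \<and> each_covers n es k ps cs todo"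

lemma each_covers_iff:
  "each_covers n es k ps cs todo \<longleftrightarrow>
     (\<forall>p\<in>set todo. all_cover n es k (p # ps) (filter (compatible es p) cs))"
  by (induction todo) auto

lemma forces_append: "forces G (qs @ ps) \<Longrightarrow> forces G ps"
  using forces_drop[of G "qs @ ps" "length qs"] by simp

lemma all_cover_sound:
  assumes "all_cover n es k ps cs" "set cs = {p. forces (graph_of n es) (p # ps)}"
    and "forces (graph_of n es) (qs @ ps)" "length qs = k"
  shows "{..<n} \<subseteq> support (qs @ ps)"
  using assms
proof (induction k arbitrary: ps cs qs)
  case (Suc k)
  \<comment> \<open>The search grows the sequence from its back, so the pair next to
    \<open>ps\<close> is split off first.\<close>
  obtain rs p where qs: "qs = rs @ [p]"
    using Suc.prems(4) by (cases qs rule: rev_cases) auto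
  have "p \<in> set cs"
    using Suc.prems(2,3) forces_append[of _ rs "p # ps"] by (simp add: qs)
  then have "all_cover n es k (p # ps) (filter (compatible es p) cs)"
    using Suc.prems(1) by (simp add: each_covers_iff)
  from Suc.IH[OF this candidates_Cons[OF Suc.prems(2) \<open>p \<in> set cs\<close>], of rs] show ?case
    using Suc.prems(3,4) by (simp add: qs)
qed simp

fun some_forces :: "(nat \<times> nat) list \<Rightarrow> nat \<Rightarrow> (nat \<times> nat) list \<Rightarrow> (nat \<times> nat) list \<Rightarrow> bool" where
  "some_forces es 0 cs todo \<longleftrightarrow> True"
| "some_forces es (Suc k) cs [] \<longleftrightarrow> False"
| "some_forces es (Suc k) cs (p # todo) \<longleftrightarrow>
     (if some_forces es k (filter (compatible es p) cs) (filter (compatible es p) cs) then True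
      else some_forces es (Suc k) cs todo)"

lemma some_forces_sound:
  assumes "some_forces es k cs todo" "set todo \<subseteq> set cs" "forces (graph_of n es) ps"
    and "set cs = {p. forces (graph_of n es) (p # ps)}"
  shows "\<exists>qs. forces (graph_of n es) (qs @ ps) \<and> length qs = k"
  using assms
proof (induction es k cs todo arbitrary: ps rule: some_forces.induct)
  case (3 es k cs p todo)
  show ?case
  proof (cases "some_forces es k (filter (compatible es p) cs) (filter (compatible es p) cs)")
    case True
    have "p \<in> set cs" using "3.prems"(2) by simp
    then have "forces (graph_of n es) (p # ps)" using "3.prems"(4) by blast
    then obtain qs where "forces (graph_of n es) (qs @ p # ps)" "length qs = k"
      using "3.IH"(1)[OF True order_refl _ candidates_Cons[OF "3.prems"(4) \<open>p \<in> set cs\<close>]] by blast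
    then show ?thesis by (intro exI[of _ "qs @ [p]"]) simp
  next
    case False
    then show ?thesis using "3.prems" by (intro "3.IH"(2)) simp_all
  qed
qed simp_all

text \<open>An executable form of the criterion \<open>Forb_mz_le_iff\<close>. Both searches start
  at the empty sequence, whose candidates are the edges in both directions.\<close>

definition minimal_forbidden :: "nat \<Rightarrow> nat \<Rightarrow> (nat \<times> nat) list \<Rightarrow> bool" where
  "minimal_forbidden k n es \<longleftrightarrow> (\<forall>(i, j)\<in>set es. i < n \<and> j < n \<and> i \<noteq> j)
     \<and> some_forces es (Suc k) (es @ map prod.swap es) (es @ map prod.swap es)
     \<and> all_cover n es (Suc k) [] (es @ map prod.swap es)"

lemma graph_of_in_Forb_mz_le:
  assumes "minimal_forbidden k n es"
  shows "graph_of n es \<in> Forb_mz_le k"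
proof -
  have simple: "simple_graph (graph_of n es)"
    using assms by (auto simp: minimal_forbidden_def simple_graph_def graph_of_def)
  moreover have "\<exists>ps. forces (graph_of n es) ps \<and> length ps = Suc k"
    using some_forces_sound[OF _ order_refl _ candidates_Nil, of es "Suc k" n] assms
    by (simp add: minimal_forbidden_def)
  moreover have "support ps = {..<n}" if "forces (graph_of n es) ps" "length ps = Suc k" for ps
  proof
    show "{..<n} \<subseteq> support ps"
      using all_cover_sound[OF _ candidates_Nil, of n es "Suc k" ps] assms that
      by (simp add: minimal_forbidden_def)
    show "support ps \<subseteq> {..<n}"
      using support_subset_verts[OF simple that(1)] by (simp add: graph_of_def)
  qed
  ultimately show ?thesis by (simp add: Forb_mz_le_iff graph_of_def)
qed

lemma listed_graphs_in_Forb: "\<forall>G\<in>set listed_graphs. G \<in> Forb_mz_le 3"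
  unfolding listed_graphs_def list.set ball_simps
  by (intro conjI TrueI graph_of_in_Forb_mz_le; code_simp)

section \<open>The listed graphs are pairwise non-isomorphic\<close>

text \<open>This counts the walks with \<open>k\<close> edges that start at
  \<open>x\<close>.\<close>

fun walks_from :: "'a graph \<Rightarrow> nat \<Rightarrow> 'a \<Rightarrow> nat" where
  "walks_from G 0 x = 1"
| "walks_from G (Suc k) x = (\<Sum>y\<in>verts G. if {x, y} \<in> edges G then walks_from G k y else 0)"

definition walks :: "'a graph \<Rightarrow> nat \<Rightarrow> nat" where
  "walks G k = (\<Sum>x\<in>verts G. walks_from G k x)"

text \<open>An isomorphism carries walks to walks: induction on the length, with the sum over the
  next vertex reindexed along \<open>f\<close>.\<close>

lemma graph_iso_walks:
  assumes "graph_iso G H"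
  shows "walks G k = walks H k"
proof -
  obtain f where f: "bij_betw f (verts G) (verts H)"
      "\<And>x y. x \<in> verts G \<Longrightarrow> y \<in> verts G \<Longrightarrow> {x, y} \<in> edges G \<longleftrightarrow> {f x, f y} \<in> edges H"
    using assms unfolding graph_iso_def by blast
  have "walks_from G k x = walks_from H k (f x)" if "x \<in> verts G" for x
    using that
  proof (induction k arbitrary: x)
    case (Suc k)
    then show ?case
      by (auto simp: sum.reindex_bij_betw[OF f(1), symmetric] f(2) intro!: sum.cong)
  qed simp
  then show ?thesis
    by (simp add: walks_def sum.reindex_bij_betw[OF f(1), symmetric])
qed

section \<open>Evaluation of the walk counts\<close>

fun walks_from_list :: "nat \<Rightarrow> (nat \<times> nat) list \<Rightarrow> nat \<Rightarrow> nat \<Rightarrow> nat" where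
  "walks_from_list n es 0 x = 1"
| "walks_from_list n es (Suc k) x = sum_list (map (walks_from_list n es k) (filter (known es x) [0..<n]))"

lemma walks_from_graph_of: "walks_from (graph_of n es) k x = walks_from_list n es k x"
proof (induction k arbitrary: x)
  case (Suc k)
  have "walks_from (graph_of n es) (Suc k) x =
      (\<Sum>y\<in>{..<n}. if known es x y then walks_from_list n es k y else 0)"
    unfolding walks_from.simps edges_graph_of Suc by (simp add: graph_of_def)
  also have "\<dots> = walks_from_list n es (Suc k) x"
    by (simp add: sum_list_map_filter' sum_list_distinct_conv_sum_set atLeast0LessThan)
  finally show ?case .
qed simp

lemma walks_graph_of: "walks (graph_of n es) k = sum_list (map (walks_from_list n es k) [0..<n])"
  by (simp add: walks_def walks_from_graph_of sum_list_distinct_conv_sum_set atLeast0LessThan)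
    (simp add: graph_of_def)

text \<open>Many listed graphs have equally many vertices; the number of walks with 3 edges, which
  is the sum of deg(x) * deg(y) over ordered adjacent pairs, separates them.\<close>

lemma distinct_invariants: "distinct (map (\<lambda>G. (card (verts G), walks G 3)) listed_graphs)"
proof -
  have card: "card (verts (graph_of n es)) = n" for n es by (simp add: graph_of_def)
  show ?thesis
    unfolding listed_graphs_def list.map walks_graph_of card by code_simp
qed

theorem mainTheorem2:
  shows "length listed_graphs = 25
    \<and> (\<forall>i<25. \<forall>j<25. graph_iso (listed_graphs ! i) (listed_graphs ! j) \<longrightarrow> i = j)
    \<and> (\<forall>G\<in>set listed_graphs. G \<in> Forb_mz_le 3)
    \<and> (\<forall>H::'a graph. H \<in> Forb_mz_le 3 \<longrightarrow> (\<exists>G\<in>set listed_graphs. graph_iso H G))"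
proof (intro conjI allI impI)
  show len: "length listed_graphs = 25" by (simp add: listed_graphs_def)
  fix i j :: nat
  assume ij: "i < 25" "j < 25" and iso: "graph_iso (listed_graphs ! i) (listed_graphs ! j)"
  have "card (verts (listed_graphs ! i)) = card (verts (listed_graphs ! j))"
    using iso unfolding graph_iso_def by (blast intro: bij_betw_same_card)
  \<comment> \<open>Isomorphic graphs share both invariants, and these differ at distinct
    positions.\<close>
  then show "i = j"
    using nth_eq_iff_index_eq[OF distinct_invariants, of i j] graph_iso_walks[OF iso, of 3] ij len
    by simp
qed (use listed_graphs_in_Forb Forb_3_listed in blast)+

end
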